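(* Let $G$ be a simplicial group, let $n\ge 0$, and let $\alpha(\cdot):\{0,1,\ldots,2^n-1\}\to I^{(n)}$ be a bijection (a total order on the set $I^{(n)}$ of multi-indices of dimension $\le n$) extending the length-product partial order $\preccurlyeq$, i.e. such that $\alpha(k)\preccurlyeq\alpha(l)$ implies $k\le l$ for all $k,l$. Write $H_k := H_{\alpha(k)}$. Then there is an internal semidirect product (SDP) decomposition $$G_n = H_0 \rtimes H_1 \rtimes \cdots \rtimes H_{2^n-1}.$$
   Context: A simplicial group $G$ has groups $G_n$ ($n\ge0$, not necessarily abelian, written additively), face homomorphisms $d_i:G_n\to G_{n-1}$ and degeneracy homomorphisms $s_i:G_n\to G_{n+1}$ ($0\le i\le n$), satisfying the usual simplicial identities, with operators composed as maps acting on the left. Moore chains: $M_n = M_n(G) := \{g\in G_n : d_i(g)=0 \text{ for all } i\neq 0\}$. Multi-indices: a multi-index $\alpha$ of length $k$ and dimension $\le n$ is a strictly increasing sequence $\alpha=\{i_1<\cdots<i_k\}$ with $0\le i_p\le n-1$ for all $p$; its length is $|\alpha|:=k$ (the empty multi-index $\varnothing$, of length $0$, is allowed). $I^{(n)}$ is the set of all multi-indices of dimension $\le n$; it has $2^n$ elements. Put $s_\alpha := s_{i_k}s_{i_{k-1}}\cdots s_{i_1}:G_{n-|\alpha|}\to G_n$ (with $s_\varnothing=\mathrm{id}$) and $H_\alpha := s_\alpha(M_{n-|\alpha|})\subseteq G_n$; in particular $H_\varnothing=M_n$. Length-product partial order: for $\alpha=\{i_1<\cdots<i_k\}$ and $\beta=\{j_1<\cdots<j_l\}$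 in $I^{(n)}$, $\alpha\preccurlyeq\beta$ means that $k\le l$ and $i_{k-p}\le j_{l-p}$ for all $0\le p\le k-1$. Internal SDP: a group $G$ with subgroups $H_1,\ldots,H_r$ (in this order) is an internal $r$-semidirect product of the $H_i$, written $G=H_1\rtimes\cdots\rtimes H_r$, if (1) the set $H_1H_2\cdots H_i$ is a normal subgroup of $G$ for all $i$; and (2) every $g\in G$ can be factored uniquely as $g=h_1h_2\cdots h_r$ with $h_i\in H_i$ for all $i$. (Here this is applied with $r=2^n$ subgroups indexed from $0$ to $2^n-1$, in additive notation.) *)

theory Defs
  imports "HOL-Algebra.Coset" "HOL-Library.FuncSet"
begin

text \<open>
  Groups are written multiplicatively, following HOL-Algebra.  The operators carry the
  degree of their source: \<^term>\<open>d n i\<close> maps degree \<^term>\<open>n\<close> to degree \<^term>\<open>n - 1\<close> and is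
  constrained only for \<^prop>\<open>1 \<le> n\<close>, and \<^term>\<open>s n i\<close> maps degree \<^term>\<open>n\<close> to degree
  \<^term>\<open>n + 1\<close>.  Letting all groups have carriers in one type loses no generality.
\<close>

locale simplicial_group =
  fixes G :: "nat \<Rightarrow> ('a, 'b) monoid_scheme"
    and d :: "nat \<Rightarrow> nat \<Rightarrow> 'a \<Rightarrow> 'a"
    and s :: "nat \<Rightarrow> nat \<Rightarrow> 'a \<Rightarrow> 'a"
  assumes group: "\<And>n. group (G n)"
    and face_hom: "\<And>n i. 1 \<le> n \<Longrightarrow> i \<le> n \<Longrightarrow> d n i \<in> hom (G n) (G (n - 1))"
    and degen_hom: "\<And>n i. i \<le> n \<Longrightarrow> s n i \<in> hom (G n) (G (n + 1))"
    and face_face: "\<And>n i j x. 2 \<le> n \<Longrightarrow> i < j \<Longrightarrow> j \<le> n \<Longrightarrow> x \<in> carrier (G n) \<Longrightarrow>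
          d (n - 1) i (d n j x) = d (n - 1) (j - 1) (d n i x)"
    and degen_degen: "\<And>n i j x. i \<le> j \<Longrightarrow> j \<le> n \<Longrightarrow> x \<in> carrier (G n) \<Longrightarrow>
          s (n + 1) i (s n j x) = s (n + 1) (j + 1) (s n i x)"
    and face_degen_less: "\<And>n i j x. i < j \<Longrightarrow> j \<le> n \<Longrightarrow> x \<in> carrier (G n) \<Longrightarrow>
          d (n + 1) i (s n j x) = s (n - 1) (j - 1) (d n i x)"
    and face_degen_id: "\<And>n i j x. i = j \<or> i = j + 1 \<Longrightarrow> j \<le> n \<Longrightarrow> x \<in> carrier (G n) \<Longrightarrow>
          d (n + 1) i (s n j x) = x"
    and face_degen_greater: "\<And>n i j x. j + 1 < i \<Longrightarrow> i \<le> n + 1 \<Longrightarrow> x \<in> carrier (G n) \<Longrightarrow>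
          d (n + 1) i (s n j x) = s (n - 1) j (d n (i - 1) x)"

definition moore_chains ::
    "(nat \<Rightarrow> ('a, 'b) monoid_scheme) \<Rightarrow> (nat \<Rightarrow> nat \<Rightarrow> 'a \<Rightarrow> 'a) \<Rightarrow> nat \<Rightarrow> 'a set" where
  "moore_chains G d n =
     {g \<in> carrier (G n). \<forall>i. i \<noteq> 0 \<and> i \<le> n \<longrightarrow> d n i g = \<one>\<^bsub>G (n - 1)\<^esub>}"

definition multi_indices :: "nat \<Rightarrow> nat list set" where
  "multi_indices n = {\<alpha>. sorted_wrt (<) \<alpha> \<and> (\<forall>i\<in>set \<alpha>. i < n)}"

text \<open>
  \<^term>\<open>degen s m \<alpha>\<close> is the composite defined on degree \<^term>\<open>m\<close>, in which the first
  (smallest) entry of \<^term>\<open>\<alpha>\<close> is applied first; its values have degree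
  \<^term>\<open>m + length \<alpha>\<close>.
\<close>

primrec degen :: "(nat \<Rightarrow> nat \<Rightarrow> 'a \<Rightarrow> 'a) \<Rightarrow> nat \<Rightarrow> nat list \<Rightarrow> 'a \<Rightarrow> 'a" where
  "degen s m [] x = x"
| "degen s m (i # \<alpha>) x = degen s (m + 1) \<alpha> (s m i x)"

definition degen_moore ::
    "(nat \<Rightarrow> ('a, 'b) monoid_scheme) \<Rightarrow> (nat \<Rightarrow> nat \<Rightarrow> 'a \<Rightarrow> 'a) \<Rightarrow> (nat \<Rightarrow> nat \<Rightarrow> 'a \<Rightarrow> 'a) \<Rightarrow>
      nat \<Rightarrow> nat list \<Rightarrow> 'a set" where
  "degen_moore G d s n \<alpha> =
     degen s (n - length \<alpha>) \<alpha> ` moore_chains G d (n - length \<alpha>)"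

text \<open>List positions count from 0, so the entry with 1-based index \<open>k - p\<close> is at \<open>k - 1 - p\<close>.\<close>

definition length_product_le :: "nat list \<Rightarrow> nat list \<Rightarrow> bool" where
  "length_product_le \<alpha> \<beta> \<longleftrightarrow>
     length \<alpha> \<le> length \<beta> \<and>
     (\<forall>p < length \<alpha>. \<alpha> ! (length \<alpha> - 1 - p) \<le> \<beta> ! (length \<beta> - 1 - p))"

primrec ordered_prod :: "('a, 'b) monoid_scheme \<Rightarrow> (nat \<Rightarrow> 'a) \<Rightarrow> nat \<Rightarrow> 'a" where
  "ordered_prod G h 0 = \<one>\<^bsub>G\<^esub>"
| "ordered_prod G h (Suc i) = ordered_prod G h i \<otimes>\<^bsub>G\<^esub> h i"

primrec ordered_set_prod :: "('a, 'b) monoid_scheme \<Rightarrow> (nat \<Rightarrow> 'a set) \<Rightarrow> nat \<Rightarrow> 'a set" where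
  "ordered_set_prod G H 0 = {\<one>\<^bsub>G\<^esub>}"
| "ordered_set_prod G H (Suc i) = ordered_set_prod G H i <#>\<^bsub>G\<^esub> H i"

text \<open>
  The subgroups are indexed by \<open>0, \<dots>, r - 1\<close>.  Factor tuples are taken in the extensional
  product so that uniqueness only concerns these indices.
\<close>

definition internal_SDP :: "('a, 'b) monoid_scheme \<Rightarrow> nat \<Rightarrow> (nat \<Rightarrow> 'a set) \<Rightarrow> bool" where
  "internal_SDP G r H \<longleftrightarrow>
     group G \<and>
     (\<forall>i<r. subgroup (H i) G) \<and>
     (\<forall>i. 1 \<le> i \<and> i \<le> r \<longrightarrow> ordered_set_prod G H i \<lhd> G) \<and>
     (\<forall>g\<in>carrier G. \<exists>!h. h \<in> (\<Pi>\<^sub>E i\<in>{..<r}. H i) \<and> g = ordered_prod G h r)"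

end

theory Submission
  imports Defs
begin

text \<open>
  Each multi-index \<open>\<beta>\<close> gives, besides the degeneracy \<open>s\<^sub>\<beta>\<close>, an iterated face
  \<open>d\<^sub>\<beta> = d\<^bsub>i\<^sub>1+1\<^esub> \<dots> d\<^bsub>i\<^sub>k+1\<^esub>\<close> of \<open>G\<^sub>n\<close> with \<open>d\<^sub>\<beta> s\<^sub>\<beta> = id\<close>.  The proof rests on two facts about these homomorphisms.

  \<^item> Triangularity (\<open>faces_degen_trivial\<close>): \<open>d\<^sub>\<beta>\<close> kills \<open>s\<^sub>\<alpha>(M)\<close> unless \<open>\<beta> \<preceq> \<alpha>\<close> in the
    length-product order.  Geometrically, \<open>d\<^sub>\<beta> s\<^sub>\<alpha>\<close> is induced by a monotone map fixing \<open>0\<close>;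
    if that map is not surjective, then \<open>d\<^sub>\<beta> s\<^sub>\<alpha>\<close> factors through a face \<open>d\<^sub>j\<close>, \<open>j \<noteq> 0\<close>, applied
    directly to the Moore chain and hence trivial, and if it is surjective, then counting fibres from the top gives \<open>\<beta> \<preceq> \<alpha>\<close>.
  \<^item> Face absorption (\<open>face_of_faces\<close>): for \<open>j \<noteq> 0\<close>, \<open>d\<^sub>j d\<^sub>\<alpha>\<close> is again some \<open>d\<^sub>\<beta>\<close>, with \<open>\<beta>\<close> strictly
    above \<open>\<alpha>\<close>.

  Along a linear extension \<open>\<alpha>(0), \<alpha>(1), \<dots>\<close> of the order, let \<open>N\<^sub>i\<close> be the set of elements killed by
  all \<open>d\<^bsub>\<alpha>(k)\<^esub>\<close> with \<open>k \<ge> i\<close>.  It is an intersection of kernels, hence normal without any commutator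
  computation.  Triangularity puts \<open>H\<^sub>0, \<dots>, H\<^bsub>i-1\<^esub>\<close> inside \<open>N\<^sub>i\<close>.  Conversely, for \<open>g\<close> in
  \<open>N\<^bsub>i+1\<^esub>\<close>, face absorption makes \<open>x = d\<^bsub>\<alpha>(i)\<^esub> g\<close> a Moore chain, so
  \<open>h = s\<^bsub>\<alpha>(i)\<^esub> x\<close> lies in \<open>H\<^sub>i\<close>, and \<open>g h\<^sup>-\<^sup>1\<close> lies in \<open>N\<^sub>i\<close>.  Thus \<open>N\<^sub>i = H\<^sub>0 \<dots> H\<^bsub>i-1\<^esub>\<close>,
  and the last factor of an element of \<open>N\<^bsub>i+1\<^esub>\<close> can be read off with \<open>d\<^bsub>\<alpha>(i)\<^esub>\<close>.  This group-theoretic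
  part is isolated in \<open>internal_SDP_by_triangular_homs\<close>.
\<close>

section \<open>Semidirect products from triangular families of homomorphisms\<close>

text \<open>
  The homomorphisms \<open>\<phi>\<^sub>l\<close> act as coordinates: they turn the partial products into common kernels
  and so make normality automatic, and they recover the factors from right to left.
\<close>

lemma internal_SDP_by_triangular_homs:
  fixes K :: "('a, 'b) monoid_scheme" and L :: "nat \<Rightarrow> ('c, 'e) monoid_scheme"
  assumes K: "group K" and L: "\<And>l. l < r \<Longrightarrow> group (L l)"
    and hom: "\<And>l. l < r \<Longrightarrow> \<phi> l \<in> hom K (L l)"
    and sub: "\<And>k. k < r \<Longrightarrow> subgroup (H k) K"
    and triangular: "\<And>k l h. k < l \<Longrightarrow> l < r \<Longrightarrow> h \<in> H k \<Longrightarrow> \<phi> l h = \<one>\<^bsub>L l\<^esub>"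
    and inj: "\<And>k. k < r \<Longrightarrow> inj_on (\<phi> k) (H k)"
    and lift: "\<And>k g. k < r \<Longrightarrow> g \<in> carrier K \<Longrightarrow>
        (\<And>l. k < l \<Longrightarrow> l < r \<Longrightarrow> \<phi> l g = \<one>\<^bsub>L l\<^esub>) \<Longrightarrow> \<exists>h\<in>H k. \<phi> k h = \<phi> k g"
    and separating: "\<And>g. g \<in> carrier K \<Longrightarrow> (\<And>l. l < r \<Longrightarrow> \<phi> l g = \<one>\<^bsub>L l\<^esub>) \<Longrightarrow> g = \<one>\<^bsub>K\<^esub>"
  shows "internal_SDP K r H"
proof -
  interpret K: group K by (rule K)
  define N where "N i = {g \<in> carrier K. \<forall>l. i \<le> l \<and> l < r \<longrightarrow> \<phi> l g = \<one>\<^bsub>L l\<^esub>}" for i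
  have gh: "group_hom K (L l) (\<phi> l)" if "l < r" for l
    using that K L hom by (simp add: group_hom_def group_hom_axioms_def)
  have H_carrier: "h \<in> carrier K" if "k < r" "h \<in> H k" for k h
    using sub that subgroup.mem_carrier by metis
  have mult: "\<phi> l (x \<otimes>\<^bsub>K\<^esub> y) = \<phi> l x \<otimes>\<^bsub>L l\<^esub> \<phi> l y"
    if "l < r" "x \<in> carrier K" "y \<in> carrier K" for l x y
    using hom that by (simp add: hom_mult)
  have closed: "\<phi> l x \<in> carrier (L l)" if "l < r" "x \<in> carrier K" for l x
    using hom that by (meson hom_in_carrier)
  have inv: "\<phi> l (inv\<^bsub>K\<^esub> x) = inv\<^bsub>L l\<^esub> (\<phi> l x)" if "l < r" "x \<in> carrier K" for l x
    using group_hom.hom_inv[OF gh] that by simp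
  have one: "\<phi> l \<one>\<^bsub>K\<^esub> = \<one>\<^bsub>L l\<^esub>" if "l < r" for l
    using group_hom.hom_one[OF gh] that by simp
  note L_simps = monoid.l_one[OF group.is_monoid] monoid.r_one[OF group.is_monoid]
    monoid.one_closed[OF group.is_monoid]
  have N_sub: "subgroup (N i) K" for i
  proof (rule K.subgroupI)
    show "N i \<subseteq> carrier K" by (auto simp: N_def)
    show "N i \<noteq> {}" using one by (auto simp: N_def)
    show "inv\<^bsub>K\<^esub> a \<in> N i" if "a \<in> N i" for a
      using that L by (auto simp: N_def inv monoid.inv_one[OF group.is_monoid])
    show "a \<otimes>\<^bsub>K\<^esub> b \<in> N i" if "a \<in> N i" "b \<in> N i" for a b
      using that L by (auto simp: N_def mult L_simps)
  qed
  have N_normal: "N i \<lhd> K" for i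
  proof (rule K.normal_invI[OF N_sub])
    fix x h assume x: "x \<in> carrier K" and h: "h \<in> N i"
    then show "x \<otimes>\<^bsub>K\<^esub> h \<otimes>\<^bsub>K\<^esub> inv\<^bsub>K\<^esub> x \<in> N i"
      using L by (auto simp: N_def mult inv closed L_simps group.r_inv)
  qed
  have H_N: "H k \<subseteq> N (Suc k)" if "k < r" for k
    unfolding N_def using that triangular[of k] H_carrier[of k] by (auto simp: Suc_le_eq)
  have prod_eq: "ordered_set_prod K H i = N i" if "i \<le> r" for i
    using that
  proof (induction i)
    case 0
    have "N 0 = {\<one>\<^bsub>K\<^esub>}"
      using separating one by (auto simp: N_def)
    then show ?case by simp
  next
    case (Suc i)
    then have i: "i < r" by simp
    have "N i <#>\<^bsub>K\<^esub> H i \<subseteq> N (Suc i)"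
    proof -
      have "N i \<subseteq> N (Suc i)" by (auto simp: N_def)
      then show ?thesis
        using H_N[OF i] subgroup.m_closed[OF N_sub] by (fastforce simp: set_mult_def)
    qed
    moreover have "N (Suc i) \<subseteq> N i <#>\<^bsub>K\<^esub> H i"
    proof
      fix g assume g: "g \<in> N (Suc i)"
      then have gc: "g \<in> carrier K" by (simp add: N_def)
      obtain h where h: "h \<in> H i" "\<phi> i h = \<phi> i g"
        using lift[OF i gc] g by (auto simp: N_def)
      have hc: "h \<in> carrier K" using H_carrier i h by blast
      have "g \<otimes>\<^bsub>K\<^esub> inv\<^bsub>K\<^esub> h \<in> N i"
      proof -
        have "g \<otimes>\<^bsub>K\<^esub> inv\<^bsub>K\<^esub> h \<in> N (Suc i)"
          using g h H_N[OF i] subgroup.m_closed[OF N_sub] subgroup.m_inv_closed[OF N_sub] by blast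
        moreover have "\<phi> i (g \<otimes>\<^bsub>K\<^esub> inv\<^bsub>K\<^esub> h) = \<one>\<^bsub>L i\<^esub>"
          using i gc hc h L by (simp add: mult inv closed group.r_inv)
        ultimately show ?thesis
          by (auto simp: N_def) (metis le_neq_implies_less less_eq_Suc_le)
      qed
      moreover have "g = (g \<otimes>\<^bsub>K\<^esub> inv\<^bsub>K\<^esub> h) \<otimes>\<^bsub>K\<^esub> h"
        using gc hc by (simp add: K.m_assoc)
      ultimately show "g \<in> N i <#>\<^bsub>K\<^esub> H i"
        using h unfolding set_mult_def by blast
    qed
    ultimately show ?case using Suc by simp
  qed
  have factor: "\<exists>h \<in> (\<Pi>\<^sub>E k\<in>{..<i}. H k). g = ordered_prod K h i"
    if "g \<in> ordered_set_prod K H i" for g i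
    using that
  proof (induction i arbitrary: g)
    case (Suc i)
    then obtain a b where ab: "a \<in> ordered_set_prod K H i" "b \<in> H i" "g = a \<otimes>\<^bsub>K\<^esub> b"
      by (auto simp: set_mult_def)
    then obtain h where h: "h \<in> (\<Pi>\<^sub>E k\<in>{..<i}. H k)" "a = ordered_prod K h i"
      using Suc.IH by blast
    have "ordered_prod K (h(i := b)) j = ordered_prod K h j" if "j \<le> i" for j
      using that by (induction j) auto
    then have "g = ordered_prod K (h(i := b)) (Suc i)"
      using h ab by simp
    moreover have "h(i := b) \<in> (\<Pi>\<^sub>E k\<in>{..<Suc i}. H k)"
      using h ab by (simp add: lessThan_Suc PiE_fun_upd)
    ultimately show ?case by blast
  qed auto
  have in_N: "ordered_prod K h i \<in> N i" if "i \<le> r" "\<And>k. k < i \<Longrightarrow> h k \<in> H k" for h i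
  proof -
    have "ordered_prod K h i \<in> ordered_set_prod K H i"
      using that(2) by (induction i) (force simp: set_mult_def)+
    then show ?thesis using prod_eq that by simp
  qed
  have unique: "\<forall>k<i. h k = h' k"
    if "i \<le> r" "\<And>k. k < i \<Longrightarrow> h k \<in> H k" "\<And>k. k < i \<Longrightarrow> h' k \<in> H k"
      "ordered_prod K h i = ordered_prod K h' i" for h h' i
    using that
  proof (induction i)
    case (Suc i)
    then have i: "i < r" by simp
    have P: "ordered_prod K h i \<in> N i" "ordered_prod K h' i \<in> N i"
      using Suc.prems by (auto intro!: in_N)
    then have Pc: "ordered_prod K h i \<in> carrier K" "ordered_prod K h' i \<in> carrier K"
      by (auto simp: N_def)
    have H: "h i \<in> H i" "h' i \<in> H i" using Suc.prems by auto
    then have Hc: "h i \<in> carrier K" "h' i \<in> carrier K" using H_carrier i by auto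
    have "\<phi> i (ordered_prod K h i \<otimes>\<^bsub>K\<^esub> h i) = \<phi> i (h i)"
      and "\<phi> i (ordered_prod K h' i \<otimes>\<^bsub>K\<^esub> h' i) = \<phi> i (h' i)"
      using P Pc Hc i L by (auto simp: mult closed N_def L_simps)
    then have "\<phi> i (h i) = \<phi> i (h' i)"
      using Suc.prems(4) by simp
    then have eq: "h i = h' i"
      using inj[OF i] H by (auto dest: inj_onD)
    then have "ordered_prod K h i = ordered_prod K h' i"
      using Suc.prems(4) Pc Hc by simp
    then show ?case
      using Suc eq by (auto simp: less_Suc_eq)
  qed simp
  have "\<exists>!h. h \<in> (\<Pi>\<^sub>E k\<in>{..<r}. H k) \<and> g = ordered_prod K h r" if "g \<in> carrier K" for g
  proof -
    have "g \<in> ordered_set_prod K H r"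
      using that prod_eq[of r] by (auto simp: N_def)
    then obtain h where h: "h \<in> (\<Pi>\<^sub>E k\<in>{..<r}. H k)" "g = ordered_prod K h r"
      using factor by blast
    show ?thesis
    proof (rule ex1I[of _ h])
      fix h' assume h': "h' \<in> (\<Pi>\<^sub>E k\<in>{..<r}. H k) \<and> g = ordered_prod K h' r"
      then have "\<forall>k<r. h' k = h k"
        using h by (intro unique) auto
      then show "h' = h"
        using h h' by (auto intro: PiE_ext)
    qed (use h in simp)
  qed
  then show ?thesis
    using K sub prod_eq N_normal by (auto simp: internal_SDP_def)
qed

section \<open>Multi-indices and the length-product order\<close>

lemma multi_indices_mono: "m \<le> n \<Longrightarrow> \<beta> \<in> multi_indices m \<Longrightarrow> \<beta> \<in> multi_indices n"
  by (auto simp: multi_indices_def)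

lemma multi_indices_snoc:
  "\<beta> @ [i] \<in> multi_indices (Suc n) \<longleftrightarrow> \<beta> \<in> multi_indices i \<and> i \<le> n"
  by (auto simp: multi_indices_def sorted_wrt_append)

lemma multi_indices_length_le:
  assumes "\<beta> \<in> multi_indices n"
  shows "length \<beta> \<le> n"
proof -
  have "distinct \<beta>" "set \<beta> \<subseteq> {..<n}"
    using assms strict_sorted_iff by (auto simp: multi_indices_def)
  then show ?thesis
    by (metis card_lessThan card_mono distinct_card finite_lessThan)
qed

lemma length_product_le_Nil: "length_product_le [] \<alpha>"
  by (simp add: length_product_le_def)

text \<open>The order compares entries from the right, so it is transparent for lists grown at the end.\<close>

lemma length_product_le_snoc:
  "length_product_le (\<beta> @ [i]) (\<alpha> @ [j]) \<longleftrightarrow> i \<le> j \<and> length_product_le \<beta> \<alpha>"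
proof -
  have "(\<forall>p < Suc (length \<beta>). (\<beta> @ [i]) ! (length \<beta> - p) \<le> (\<alpha> @ [j]) ! (length \<alpha> - p))
      \<longleftrightarrow> i \<le> j \<and> (\<forall>p < length \<beta>. \<beta> ! (length \<beta> - 1 - p) \<le> \<alpha> ! (length \<alpha> - 1 - p))"
    if le: "length \<beta> \<le> length \<alpha>"
  proof -
    have "(\<beta> @ [i]) ! (length \<beta> - Suc p) = \<beta> ! (length \<beta> - 1 - p)"
      and "(\<alpha> @ [j]) ! (length \<alpha> - Suc p) = \<alpha> ! (length \<alpha> - 1 - p)" if "p < length \<beta>" for p
      using that le by (auto simp: nth_append)
    then show ?thesis
      by (simp add: All_less_Suc2)
  qed
  then show ?thesis
    by (auto simp: length_product_le_def)
qed

lemma length_product_le_Cons_right: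
  assumes "length_product_le \<alpha> \<beta>"
  shows "length_product_le \<alpha> (b # \<beta>)"
proof -
  have "(b # \<beta>) ! (length \<beta> - p) = \<beta> ! (length \<beta> - 1 - p)" if "p < length \<alpha>" for p
    using that assms by (simp add: length_product_le_def nth_Cons')
  then show ?thesis using assms by (auto simp: length_product_le_def)
qed

lemma length_product_le_refl: "length_product_le \<alpha> \<alpha>"
  by (simp add: length_product_le_def)

lemma length_product_le_Cons_left:
  assumes "length_product_le \<alpha> \<beta>" "length \<beta> = Suc (length \<alpha>)" "a \<le> \<beta> ! 0"
  shows "length_product_le (a # \<alpha>) \<beta>"
proof -
  have "(a # \<alpha>) ! (length \<alpha> - p) \<le> \<beta> ! (length \<alpha> - p)" if "p < Suc (length \<alpha>)" for p
  proof (cases "p = length \<alpha>")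
    case False
    then have "p < length \<alpha>" using that by simp
    then show ?thesis
      using assms by (simp add: length_product_le_def nth_Cons')
  qed (use assms in simp)
  then show ?thesis using assms by (auto simp: length_product_le_def)
qed

lemma length_product_le_snoc_right:
  assumes "length_product_le \<beta> \<alpha>" "\<And>i. i \<in> set \<alpha> \<Longrightarrow> i \<le> j" "sorted_wrt (<) \<alpha>"
  shows "length_product_le \<beta> (\<alpha> @ [j])"
  using assms
proof (induction \<beta> arbitrary: \<alpha> j rule: rev_induct)
  case (snoc i \<beta>)
  then obtain \<alpha>' j' where \<alpha>: "\<alpha> = \<alpha>' @ [j']"
    by (cases \<alpha> rule: rev_cases) (auto simp: length_product_le_def)
  have "i \<le> j'" "length_product_le \<beta> \<alpha>'"
    using snoc.prems \<alpha> by (auto simp: length_product_le_snoc)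
  moreover have "length_product_le \<beta> (\<alpha>' @ [j'])"
    using snoc.prems \<alpha> calculation
    by (intro snoc.IH) (auto simp: sorted_wrt_append less_imp_le)
  ultimately show ?case
    using snoc.prems \<alpha> length_product_le_snoc[of \<beta> i "\<alpha>' @ [j']" j] le_trans[of i j' j] by auto
qed (rule length_product_le_Nil)

section \<open>Iterated faces dual to the degeneracies\<close>

text \<open>
  The shift \<open>i + 1\<close> serves two purposes: \<open>d\<^bsub>i+1\<^esub> s\<^sub>i = id\<close>, and the face \<open>d\<^sub>0\<close>, which Moore chains do
  not control, never occurs.  As for \<^const>\<open>degen\<close>, the degree \<open>m\<close> is the smaller one, here that of the values.
\<close>

primrec faces :: "(nat \<Rightarrow> nat \<Rightarrow> 'a \<Rightarrow> 'a) \<Rightarrow> nat \<Rightarrow> nat list \<Rightarrow> 'a \<Rightarrow> 'a" where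
  "faces d m [] x = x"
| "faces d m (i # \<beta>) x = d (m + 1) (i + 1) (faces d (m + 1) \<beta> x)"

lemma faces_snoc: "faces d m (\<beta> @ [i]) x = faces d m \<beta> (d (Suc (m + length \<beta>)) (Suc i) x)"
  by (induction \<beta> arbitrary: m) auto

lemma degen_snoc: "degen s m (\<alpha> @ [j]) x = s (m + length \<alpha>) j (degen s m \<alpha> x)"
  by (induction \<alpha> arbitrary: m x) auto

context simplicial_group
begin

lemma face_closed: "1 \<le> n \<Longrightarrow> i \<le> n \<Longrightarrow> x \<in> carrier (G n) \<Longrightarrow> d n i x \<in> carrier (G (n - 1))"
  using face_hom by (meson hom_in_carrier)

lemma degen_one_one: "i \<le> n \<Longrightarrow> s n i \<one>\<^bsub>G n\<^esub> = \<one>\<^bsub>G (n + 1)\<^esub>"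
  using degen_hom group hom_one by metis

lemma faces_hom:
  "\<beta> \<in> multi_indices (m + length \<beta>) \<Longrightarrow> faces d m \<beta> \<in> hom (G (m + length \<beta>)) (G m)"
proof (induction \<beta> rule: rev_induct)
  case Nil
  then show ?case by (auto simp: hom_def)
next
  case (snoc i \<beta>)
  then have i: "\<beta> \<in> multi_indices i" "i \<le> m + length \<beta>"
    by (simp_all add: multi_indices_snoc)
  then have "faces d m \<beta> \<in> hom (G (m + length \<beta>)) (G m)"
    using snoc.IH multi_indices_mono by blast
  moreover have "d (Suc (m + length \<beta>)) (Suc i) \<in> hom (G (Suc (m + length \<beta>))) (G (m + length \<beta>))"
    using face_hom[of "Suc (m + length \<beta>)" "Suc i"] i by simp
  ultimately show ?case
    by (auto simp: hom_def faces_snoc Pi_iff)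
qed

lemma degen_comp_hom:
  "\<alpha> \<in> multi_indices (m + length \<alpha>) \<Longrightarrow> degen s m \<alpha> \<in> hom (G m) (G (m + length \<alpha>))"
proof (induction \<alpha> rule: rev_induct)
  case Nil
  then show ?case by (auto simp: hom_def)
next
  case (snoc i \<alpha>)
  then have i: "\<alpha> \<in> multi_indices i" "i \<le> m + length \<alpha>"
    by (simp_all add: multi_indices_snoc)
  then have "degen s m \<alpha> \<in> hom (G m) (G (m + length \<alpha>))"
    using snoc.IH multi_indices_mono by blast
  moreover have "s (m + length \<alpha>) i \<in> hom (G (m + length \<alpha>)) (G (Suc (m + length \<alpha>)))"
    using degen_hom[of i "m + length \<alpha>"] i by simp
  ultimately show ?case
    by (auto simp: hom_def degen_snoc Pi_iff)
qed

lemma faces_one: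
  "\<beta> \<in> multi_indices (m + length \<beta>) \<Longrightarrow> faces d m \<beta> \<one>\<^bsub>G (m + length \<beta>)\<^esub> = \<one>\<^bsub>G m\<^esub>"
  using faces_hom group hom_one by metis

lemma degen_closed:
  "\<alpha> \<in> multi_indices (m + length \<alpha>) \<Longrightarrow> x \<in> carrier (G m) \<Longrightarrow>
    degen s m \<alpha> x \<in> carrier (G (m + length \<alpha>))"
  using degen_comp_hom by (meson hom_in_carrier)

lemma faces_degen_self:
  "\<alpha> \<in> multi_indices (m + length \<alpha>) \<Longrightarrow> x \<in> carrier (G m) \<Longrightarrow>
    faces d m \<alpha> (degen s m \<alpha> x) = x"
proof (induction \<alpha> rule: rev_induct)
  case (snoc i \<alpha>)
  then have i: "\<alpha> \<in> multi_indices (m + length \<alpha>)" "i \<le> m + length \<alpha>"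
    by (auto simp: multi_indices_snoc intro: multi_indices_mono)
  then show ?case
    using snoc face_degen_id[of "Suc i" i "m + length \<alpha>" "degen s m \<alpha> x"] degen_closed
    by (simp add: faces_snoc degen_snoc)
qed simp

section \<open>Triangularity\<close>

text \<open>
  A face beyond all entries of \<open>\<alpha>\<close> slides through every degeneracy and, its index staying positive,
  finally hits the Moore chain.
\<close>

lemma high_face_degen_trivial:
  "\<alpha> \<in> multi_indices i \<Longrightarrow> i < m + length \<alpha> \<Longrightarrow> x \<in> moore_chains G d m \<Longrightarrow>
    d (m + length \<alpha>) (Suc i) (degen s m \<alpha> x) = \<one>\<^bsub>G (m + length \<alpha> - 1)\<^esub>"
proof (induction \<alpha> arbitrary: i rule: rev_induct)
  case Nil
  then show ?case by (simp add: moore_chains_def)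
next
  case (snoc j \<alpha>)
  obtain i' where i': "i = Suc i'" "\<alpha> \<in> multi_indices j" "j \<le> i'"
    using snoc.prems(1) by (cases i) (auto simp: multi_indices_snoc, simp add: multi_indices_def)
  let ?n = "m + length \<alpha>"
  have \<alpha>: "\<alpha> \<in> multi_indices i'" "\<alpha> \<in> multi_indices ?n" "i' < ?n"
    using i' snoc.prems multi_indices_mono[of j i'] multi_indices_mono[of j ?n] by auto
  have x: "x \<in> carrier (G m)" using snoc.prems by (simp add: moore_chains_def)
  have "d (?n + 1) (Suc i) (s ?n j (degen s m \<alpha> x)) = s (?n - 1) j (d ?n i (degen s m \<alpha> x))"
    using i' snoc.prems \<alpha> x face_degen_greater[of j "Suc i" ?n] degen_closed by simp
  also have "d ?n i (degen s m \<alpha> x) = \<one>\<^bsub>G (?n - 1)\<^esub>"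
    using snoc.IH[OF \<alpha>(1,3) snoc.prems(3)] i' by simp
  also have "s (?n - 1) j \<one>\<^bsub>G (?n - 1)\<^esub> = \<one>\<^bsub>G ?n\<^esub>"
    using degen_one_one[of j "?n - 1"] i' \<alpha> by (cases ?n) auto
  finally show ?case by (simp add: degen_snoc)
qed

text \<open>If every face lies strictly below \<open>s\<^sub>j\<close>, then each one merely lowers the index \<open>j\<close> by one.\<close>

lemma low_faces_degen_commute:
  "\<beta> \<in> multi_indices (j - 1) \<Longrightarrow> j \<le> m + length \<beta> \<Longrightarrow> y \<in> carrier (G (m + length \<beta>)) \<Longrightarrow>
    faces d (Suc m) \<beta> (s (m + length \<beta>) j y) = s m (j - length \<beta>) (faces d m \<beta> y)"
proof (induction \<beta> arbitrary: j y rule: rev_induct)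
  case (snoc i \<beta>)
  have "i < j - 1" using snoc.prems(1) by (simp add: multi_indices_def)
  then obtain j' where j': "j = Suc (Suc j')" "i \<le> j'"
    by (intro that[of "j - 2"]) auto
  then have \<beta>: "\<beta> \<in> multi_indices i"
    using snoc.prems(1) by (simp add: multi_indices_snoc)
  let ?n = "m + length \<beta>"
  have y: "y \<in> carrier (G (Suc ?n))" using snoc.prems by simp
  have "faces d (Suc m) (\<beta> @ [i]) (s (Suc ?n) j y)
      = faces d (Suc m) \<beta> (d (Suc (Suc ?n)) (Suc i) (s (Suc ?n) j y))"
    by (simp add: faces_snoc)
  also have "d (Suc (Suc ?n)) (Suc i) (s (Suc ?n) j y) = s ?n (Suc j') (d (Suc ?n) (Suc i) y)"
    using face_degen_less[of "Suc i" j "Suc ?n" y] y j' snoc.prems by simp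
  also have "faces d (Suc m) \<beta> \<dots> = s m (Suc j' - length \<beta>) (faces d m \<beta> (d (Suc ?n) (Suc i) y))"
  proof (rule snoc.IH)
    show "\<beta> \<in> multi_indices (Suc j' - 1)" using j' \<beta> multi_indices_mono by simp
    show "Suc j' \<le> ?n" using snoc.prems j' by simp
    show "d (Suc ?n) (Suc i) y \<in> carrier (G ?n)"
      using face_closed[of "Suc ?n" "Suc i" y] y j' snoc.prems by simp
  qed
  finally show ?case using j' by (simp add: faces_snoc)
qed simp

text \<open>
  The outermost face \<open>d\<^bsub>i+1\<^esub>\<close> meets the outermost degeneracy \<open>s\<^sub>j\<close> in one of three ways: they
  cancel (\<open>i = j\<close> or \<open>i = j - 1\<close>), the face slides down onto the Moore chain (\<open>i > j\<close>), or all faces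
  slide below \<open>s\<^sub>j\<close> (\<open>i < j - 1\<close>).  The recursion this gives is that of the length-product order.
\<close>

lemma faces_degen_trivial:
  assumes "\<beta> \<in> multi_indices (m + length \<beta>)" "\<alpha> \<in> multi_indices (p + length \<alpha>)"
    and "m + length \<beta> = p + length \<alpha>" "x \<in> moore_chains G d p" "\<not> length_product_le \<beta> \<alpha>"
  shows "faces d m \<beta> (degen s p \<alpha> x) = \<one>\<^bsub>G m\<^esub>"
  using assms
proof (induction \<alpha> arbitrary: \<beta> m rule: rev_induct)
  case Nil
  then obtain \<beta>' i where \<beta>: "\<beta> = \<beta>' @ [i]"
    by (cases \<beta> rule: rev_cases) (auto simp: length_product_le_Nil)
  then have i: "\<beta>' \<in> multi_indices (m + length \<beta>')" "i < p" "p = Suc (m + length \<beta>')"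
    using Nil.prems by (auto simp: multi_indices_snoc intro: multi_indices_mono)
  have "d p (Suc i) x = \<one>\<^bsub>G (m + length \<beta>')\<^esub>"
    using Nil.prems i by (simp add: moore_chains_def)
  then show ?case using i \<beta> faces_one by (simp add: faces_snoc)
next
  case (snoc j \<alpha>)
  obtain \<beta>' i where \<beta>: "\<beta> = \<beta>' @ [i]"
    using snoc.prems by (cases \<beta> rule: rev_cases) (auto simp: length_product_le_Nil)
  let ?n = "p + length \<alpha>"
  have n: "m + length \<beta>' = ?n" using snoc.prems \<beta> by simp
  have i: "\<beta>' \<in> multi_indices i" "i \<le> ?n" "\<beta>' \<in> multi_indices (m + length \<beta>')"
    using snoc.prems(1) \<beta> n by (auto simp: multi_indices_snoc intro: multi_indices_mono)
  have j: "\<alpha> \<in> multi_indices j" "j \<le> ?n" "\<alpha> \<in> multi_indices ?n"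
    using snoc.prems(2) by (auto simp: multi_indices_snoc intro: multi_indices_mono)
  define y where "y = degen s p \<alpha> x"
  have y: "y \<in> carrier (G ?n)"
    using snoc.prems j degen_closed by (auto simp: moore_chains_def y_def)
  consider "j < i" | "i = j \<or> Suc i = j" | "Suc i < j" by linarith
  then show ?case
  proof cases
    case 1
    then have "\<alpha> @ [j] \<in> multi_indices i"
      using j by (cases i) (auto simp: multi_indices_snoc)
    then have "d (Suc ?n) (Suc i) (degen s p (\<alpha> @ [j]) x) = \<one>\<^bsub>G ?n\<^esub>"
      using high_face_degen_trivial[of "\<alpha> @ [j]" i p x] i snoc.prems by simp
    then show ?thesis
      using \<beta> n i faces_one[of \<beta>' m] by (simp add: faces_snoc)
  next
    case 2
    then have "d (Suc ?n) (Suc i) (s ?n j y) = y"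
      using face_degen_id[of "Suc i" j ?n y] j y by auto
    then have "faces d m \<beta> (degen s p (\<alpha> @ [j]) x) = faces d m \<beta>' y"
      using \<beta> n by (simp add: faces_snoc degen_snoc y_def)
    moreover have "\<not> length_product_le \<beta>' \<alpha>"
      using snoc.prems(5) 2 \<beta> by (auto simp: length_product_le_snoc)
    ultimately show ?thesis
      using snoc.IH[OF i(3) j(3) n snoc.prems(4)] by (simp add: y_def)
  next
    case 3
    then have \<beta>_low: "\<beta> \<in> multi_indices (j - 1)"
      using i \<beta> by (cases "j - 1") (auto simp: multi_indices_snoc)
    then have "length \<beta> \<le> j - 1" by (rule multi_indices_length_le)
    then obtain m' where m': "m = Suc m'" "m' + length \<beta> = ?n"
      using j n \<beta> by (cases m) auto
    have "faces d m \<beta> (s ?n j y) = s m' (j - length \<beta>) (faces d m' \<beta> y)"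
      using low_faces_degen_commute[OF \<beta>_low, of m' y] m' j y by simp
    also have "faces d m' \<beta> y = \<one>\<^bsub>G m'\<^esub>"
      unfolding y_def
    proof (rule snoc.IH)
      show "\<beta> \<in> multi_indices (m' + length \<beta>)"
        using \<beta>_low j m' multi_indices_mono[of "j - 1"] by simp
      show "\<not> length_product_le \<beta> \<alpha>"
        using snoc.prems(5) length_product_le_snoc_right[of \<beta> \<alpha> j] j(1)
        by (auto simp: multi_indices_def less_imp_le)
    qed (use m' j snoc.prems in auto)
    also have "s m' (j - length \<beta>) \<one>\<^bsub>G m'\<^esub> = \<one>\<^bsub>G m\<^esub>"
      using degen_one_one[of "j - length \<beta>" m'] m' j by simp
    finally show ?thesis by (simp add: degen_snoc y_def)
  qed
qed

section \<open>Absorbing a further face\<close>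

text \<open>
  A further face \<open>d\<^sub>j\<close> is moved inwards by \<open>d\<^sub>j d\<^bsub>i+1\<^esub> = d\<^bsub>i+1\<^esub> d\<^bsub>j+1\<^esub>\<close> until the indices increase.  The
  condition on the entries of \<open>\<beta>\<close> keeps the new entry above those already passed.
\<close>

lemma face_of_faces:
  assumes "\<alpha> \<in> multi_indices (m + length \<alpha>)" "1 \<le> j" "j \<le> m"
  obtains \<beta> where "\<beta> \<in> multi_indices (m + length \<alpha>)" "length \<beta> = Suc (length \<alpha>)"
    "length_product_le \<alpha> \<beta>" "\<And>b. b \<in> set \<beta> \<Longrightarrow> b \<in> set \<alpha> \<or> j - 1 \<le> b"
    "\<And>g. g \<in> carrier (G (m + length \<alpha>)) \<Longrightarrow> d m j (faces d m \<alpha> g) = faces d (m - 1) \<beta> g"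
  using assms
proof (induction \<alpha> arbitrary: m j thesis)
  case Nil
  show ?case
    by (rule Nil(1)[of "[j - 1]"])
      (use Nil in \<open>auto simp: multi_indices_def length_product_le_Nil\<close>)
next
  case (Cons i \<alpha>)
  have \<alpha>: "\<alpha> \<in> multi_indices (Suc m + length \<alpha>)" and i: "\<forall>a\<in>set \<alpha>. i < a" "i < Suc m + length \<alpha>"
    using Cons.prems(2) by (auto simp: multi_indices_def)
  show ?case
  proof (cases "j \<le> i")
    case True
    show ?thesis
    proof (rule Cons.prems(1)[of "(j - 1) # i # \<alpha>"])
      show "(j - 1) # i # \<alpha> \<in> multi_indices (m + length (i # \<alpha>))"
        using Cons.prems True i by (auto simp: multi_indices_def)
      show "length_product_le (i # \<alpha>) ((j - 1) # i # \<alpha>)"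
        by (intro length_product_le_Cons_right length_product_le_refl)
    qed (use Cons.prems in auto)
  next
    case False
    from Cons.prems have "1 \<le> Suc j" "Suc j \<le> Suc m" by auto
    from Cons.IH[OF _ \<alpha> this] obtain \<beta> where
      \<beta>: "\<beta> \<in> multi_indices (Suc m + length \<alpha>)" "length \<beta> = Suc (length \<alpha>)"
        "length_product_le \<alpha> \<beta>" "\<And>b. b \<in> set \<beta> \<Longrightarrow> b \<in> set \<alpha> \<or> j \<le> b"
        "\<And>g. g \<in> carrier (G (Suc m + length \<alpha>)) \<Longrightarrow>
          d (Suc m) (Suc j) (faces d (Suc m) \<alpha> g) = faces d m \<beta> g"
      by auto
    have above: "i < b" if "b \<in> set \<beta>" for b
      using \<beta>(4)[OF that] i False by auto
    show ?thesis
    proof (rule Cons.prems(1)[of "i # \<beta>"])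
      show "i # \<beta> \<in> multi_indices (m + length (i # \<alpha>))"
        using \<beta> i above by (auto simp: multi_indices_def)
      have "i \<le> \<beta> ! 0"
        using above[of "\<beta> ! 0"] \<beta>(2) by simp
      then show "length_product_le (i # \<alpha>) (i # \<beta>)"
        using \<beta> by (intro length_product_le_Cons_right length_product_le_Cons_left)
      show "b \<in> set (i # \<alpha>) \<or> j - 1 \<le> b" if "b \<in> set (i # \<beta>)" for b
        using that \<beta>(4) by fastforce
      fix g assume "g \<in> carrier (G (m + length (i # \<alpha>)))"
      then have g: "g \<in> carrier (G (Suc m + length \<alpha>))" by simp
      have "faces d (Suc m) \<alpha> g \<in> carrier (G (Suc m))"
        using faces_hom[OF \<alpha>] g by (meson hom_in_carrier)
      then have "d m j (faces d m (i # \<alpha>) g) = d m (Suc i) (faces d m \<beta> g)"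
        using face_face[of "Suc m" "Suc i" "Suc j" "faces d (Suc m) \<alpha> g"] \<beta>(5)[OF g]
          Cons.prems False by simp
      then show "d m j (faces d m (i # \<alpha>) g) = faces d (m - 1) (i # \<beta>) g"
        using Cons.prems by simp
    qed (use \<beta> in auto)
  qed
qed

section \<open>The decomposition\<close>

lemma moore_chains_subgroup: "subgroup (moore_chains G d n) (G n)"
proof -
  interpret Gn: group "G n" by (rule group)
  have gh: "group_hom (G n) (G (n - 1)) (d n i)" if "i \<noteq> 0" "i \<le> n" for i
    using that group face_hom by (simp add: group_hom_def group_hom_axioms_def)
  show ?thesis
  proof (rule Gn.subgroupI)
    show "moore_chains G d n \<noteq> {}"
      using group_hom.hom_one[OF gh] by (auto simp: moore_chains_def)
    show "inv\<^bsub>G n\<^esub> a \<in> moore_chains G d n" if "a \<in> moore_chains G d n" for a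
      using that group_hom.hom_inv[OF gh] monoid.inv_one[OF group.is_monoid[OF group]] by (auto simp: moore_chains_def)
    show "a \<otimes>\<^bsub>G n\<^esub> b \<in> moore_chains G d n"
      if "a \<in> moore_chains G d n" "b \<in> moore_chains G d n" for a b
      using that group_hom.hom_mult[OF gh] monoid.l_one[OF group.is_monoid[OF group]]
        monoid.one_closed[OF group.is_monoid[OF group]]
      by (auto simp: moore_chains_def)
  qed (auto simp: moore_chains_def)
qed

lemma degen_moore_subgroup:
  assumes "\<alpha> \<in> multi_indices n"
  shows "subgroup (degen_moore G d s n \<alpha>) (G n)"
proof -
  define m where "m = n - length \<alpha>"
  have n: "n = m + length \<alpha>"
    using multi_indices_length_le[OF assms] by (simp add: m_def)
  have "group_hom (G m) (G n) (degen s m \<alpha>)"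
    using degen_comp_hom[of \<alpha> m] assms group n by (simp add: group_hom_def group_hom_axioms_def)
  then show ?thesis
    using group_hom.subgroup_img_is_subgroup moore_chains_subgroup
    by (fastforce simp: degen_moore_def m_def)
qed

end

theorem mainTheorem1:
  fixes G :: "nat \<Rightarrow> ('a, 'b) monoid_scheme"
    and d s :: "nat \<Rightarrow> nat \<Rightarrow> 'a \<Rightarrow> 'a"
    and n :: nat
    and \<alpha> :: "nat \<Rightarrow> nat list"
  assumes "simplicial_group G d s"
    and "bij_betw \<alpha> {0..<2 ^ n} (multi_indices n)"
    and "\<And>k l. k < 2 ^ n \<Longrightarrow> l < 2 ^ n \<Longrightarrow> length_product_le (\<alpha> k) (\<alpha> l) \<Longrightarrow> k \<le> l"
  shows "internal_SDP (G n) (2 ^ n) (\<lambda>k. degen_moore G d s n (\<alpha> k))"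
proof -
  interpret simplicial_group G d s by (rule assms(1))
  have \<alpha>_in: "\<alpha> k \<in> multi_indices n" if "k < 2 ^ n" for k
    using assms(2) that by (auto simp: bij_betw_def)
  have \<alpha>_onto: "\<exists>k<2 ^ n. \<alpha> k = \<beta>" if "\<beta> \<in> multi_indices n" for \<beta>
    using assms(2) that by (metis atLeastLessThan_iff bij_betw_imp_surj_on imageE)
  define m where "m k = n - length (\<alpha> k)" for k
  have n: "m k + length (\<alpha> k) = n" if "k < 2 ^ n" for k
    using multi_indices_length_le[OF \<alpha>_in[OF that]] by (simp add: m_def)
  have \<alpha>_mem: "\<alpha> k \<in> multi_indices (m k + length (\<alpha> k))" if "k < 2 ^ n" for k
    using \<alpha>_in n that by simp
  have H: "degen_moore G d s n (\<alpha> k) = degen s (m k) (\<alpha> k) ` moore_chains G d (m k)" for k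
    by (simp add: degen_moore_def m_def)
  have moore_carrier: "x \<in> carrier (G k)" if "x \<in> moore_chains G d k" for x k
    using that by (simp add: moore_chains_def)
  have hom: "faces d (m k) (\<alpha> k) \<in> hom (G n) (G (m k))" if "k < 2 ^ n" for k
    using faces_hom[OF \<alpha>_mem[OF that]] n[OF that] by simp
  show ?thesis
  proof (rule internal_SDP_by_triangular_homs[where \<phi> = "\<lambda>k. faces d (m k) (\<alpha> k)"
        and L = "\<lambda>k. G (m k)"])
    fix k l h
    assume kl: "k < l" "l < 2 ^ n" and h: "h \<in> degen_moore G d s n (\<alpha> k)"
    have k: "k < 2 ^ n" using kl by simp
    have "\<not> length_product_le (\<alpha> l) (\<alpha> k)"
      using assms(3)[of l k] kl by auto
    then show "faces d (m l) (\<alpha> l) h = \<one>\<^bsub>G (m l)\<^esub>"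
      using faces_degen_trivial[of "\<alpha> l" "m l" "\<alpha> k" "m k"] h \<alpha>_mem[OF k] \<alpha>_mem[OF kl(2)]
        n[OF k] n[OF kl(2)] by (auto simp: H)
  next
    fix k :: nat assume k: "k < 2 ^ n"
    show "inj_on (faces d (m k) (\<alpha> k)) (degen_moore G d s n (\<alpha> k))"
      using faces_degen_self[OF \<alpha>_mem[OF k]] by (auto simp: H inj_on_def moore_carrier)
  next
    fix k g
    assume k: "k < 2 ^ n" and g: "g \<in> carrier (G n)"
      and killed: "\<And>l. k < l \<Longrightarrow> l < 2 ^ n \<Longrightarrow> faces d (m l) (\<alpha> l) g = \<one>\<^bsub>G (m l)\<^esub>"
    define x where "x = faces d (m k) (\<alpha> k) g"
    have "d (m k) j x = \<one>\<^bsub>G (m k - 1)\<^esub>" if j: "j \<noteq> 0" "j \<le> m k" for j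
    proof -
      have "1 \<le> j" using j by simp
      from \<alpha>_mem[OF k] this j(2) obtain \<beta> where
        \<beta>: "\<beta> \<in> multi_indices n" "length \<beta> = Suc (length (\<alpha> k))" "length_product_le (\<alpha> k) \<beta>"
          "d (m k) j x = faces d (m k - 1) \<beta> g"
        by (rule face_of_faces) (use g n[OF k] in \<open>auto simp: x_def\<close>)
      obtain l where l: "l < 2 ^ n" "\<alpha> l = \<beta>"
        using \<alpha>_onto \<beta> by blast
      have "k \<le> l" using assms(3) k l \<beta> by blast
      moreover have "k \<noteq> l" using l \<beta> by auto
      moreover have "m l = m k - 1" using l \<beta> by (simp add: m_def)
      ultimately show ?thesis
        using killed[of l] l \<beta> by simp
    qed
    moreover have x: "x \<in> carrier (G (m k))"
      using hom[OF k] g unfolding x_def by (rule hom_in_carrier)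
    ultimately have "x \<in> moore_chains G d (m k)"
      by (simp add: moore_chains_def)
    then show "\<exists>h\<in>degen_moore G d s n (\<alpha> k). faces d (m k) (\<alpha> k) h = faces d (m k) (\<alpha> k) g"
      using faces_degen_self[OF \<alpha>_mem[OF k] x] by (auto simp: H x_def)
  next
    fix g
    assume "g \<in> carrier (G n)"
      and killed: "\<And>l. l < 2 ^ n \<Longrightarrow> faces d (m l) (\<alpha> l) g = \<one>\<^bsub>G (m l)\<^esub>"
    \<comment> \<open>The empty multi-index occurs in the list, and its iterated face is the identity.\<close>
    obtain l where "l < 2 ^ n" "\<alpha> l = []"
      using \<alpha>_onto[of "[]"] by (auto simp: multi_indices_def)
    then show "g = \<one>\<^bsub>G n\<^esub>"
      using killed[of l] by (simp add: m_def)
  qed (use group hom \<alpha>_in degen_moore_subgroup in auto)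
qed

end
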